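(* Let $\mathcal{X}$ be a complex Banach space, let $\mathcal{B}(\mathcal{X})$ be the algebra of all bounded linear operators on $\mathcal{X}$, let $\xi\in\mathbb{C}$ be fixed, and let $\phi:\mathcal{B}(\mathcal{X})\to\mathcal{B}(\mathcal{X})$ be an additive mapping. Then the following are equivalent: (i) $\phi$ is Lie centralizable at $\xi I$, i.e. for all $A,B\in\mathcal{B}(\mathcal{X})$ with $AB=\xi I$ one has $\phi([A,B])=[\phi(A),B]=[A,\phi(B)]$; (ii) there exist $\lambda\in\mathbb{C}$ and an additive mapping $\mu:\mathcal{B}(\mathcal{X})\to\mathbb{C}I$ such that $\mu([A,B])=0$ for all $A,B\in\mathcal{B}(\mathcal{X})$ with $AB=\xi I$, and $\phi(A)=\lambda A+\mu(A)$ for all $A\in\mathcal{B}(\mathcal{X})$.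
   Context: $[A,B]=AB-BA$ denotes the Lie product, $I$ is the identity operator on $\mathcal{X}$, and $\mathbb{C}I=\{\eta I:\eta\in\mathbb{C}\}$. Additive mappings are not assumed to be linear or continuous. *)

theory Defs
  imports "HOL-Analysis.Analysis"
begin

section \<open>Complex Banach spaces\<close>

text \<open>HOL-Analysis has type classes only for real normed spaces. A complex normed space
  is added here as a real one with a compatible complex scalar multiplication; completeness
  is that of the norm metric.\<close>

class scaleC =
  fixes scaleC :: "complex \<Rightarrow> 'a \<Rightarrow> 'a" (infixr "*\<^sub>C" 75)

class complex_vector = scaleC + ab_group_add +
  assumes scaleC_add_right: "a *\<^sub>C (x + y) = a *\<^sub>C x + a *\<^sub>C y"
    and scaleC_add_left: "(a + b) *\<^sub>C x = a *\<^sub>C x + b *\<^sub>C x"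
    and scaleC_scaleC: "a *\<^sub>C (b *\<^sub>C x) = (a * b) *\<^sub>C x"
    and scaleC_one: "1 *\<^sub>C x = x"

class complex_normed_vector = complex_vector + real_normed_vector +
  assumes scaleR_scaleC: "r *\<^sub>R x = complex_of_real r *\<^sub>C x"
    and norm_scaleC: "norm (a *\<^sub>C x) = cmod a * norm x"

class complex_banach = complex_normed_vector + complete_space

instantiation complex :: complex_banach
begin

definition scaleC_complex :: "complex \<Rightarrow> complex \<Rightarrow> complex"
  where "scaleC_complex a x = a * x"

instance
  by standard (simp_all add: scaleC_complex_def algebra_simps norm_mult scaleR_conv_of_real)

end

lemma scaleC_zero_right [simp]: "a *\<^sub>C (0 :: 'a::complex_vector) = 0"
  using scaleC_add_right[of a 0 "0 :: 'a"] by simp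

lemma scaleC_minus_right: "a *\<^sub>C (- x) = - (a *\<^sub>C x)" for x :: "'a::complex_vector"
proof -
  have "a *\<^sub>C x + a *\<^sub>C (- x) = 0"
    by (simp flip: scaleC_add_right)
  then show ?thesis
    by (rule minus_unique [symmetric])
qed

lemma scaleC_diff_right: "a *\<^sub>C (x - y) = a *\<^sub>C x - a *\<^sub>C y" for x y :: "'a::complex_vector"
  using scaleC_add_right[of a x "- y"] by (simp add: scaleC_minus_right)

lemma bounded_linear_scaleC_right: "bounded_linear (\<lambda>x :: 'a::complex_normed_vector. a *\<^sub>C x)"
  by (rule bounded_linear_intro[where K = "cmod a"])
    (simp_all add: scaleC_add_right scaleR_scaleC scaleC_scaleC norm_scaleC mult.commute)


section \<open>The algebra of bounded linear operators\<close>

text \<open>The library constant \<^const>\<open>bounded_linear\<close> is only real-linear, so homogeneity over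
  the complex numbers is required in addition.\<close>

typedef (overloaded) ('a::complex_normed_vector) bop =
  "{A :: 'a \<Rightarrow> 'a. bounded_linear A \<and> (\<forall>c x. A (c *\<^sub>C x) = c *\<^sub>C A x)}"
  morphisms bop_apply Bop
  by (rule exI[of _ "\<lambda>x. 0"]) simp

setup_lifting type_definition_bop

lemma bop_eqI: "(\<And>x. bop_apply A x = bop_apply B x) \<Longrightarrow> A = B"
  by transfer auto

text \<open>Multiplication is composition of operators. The zero space is not excluded, so
  \<open>0 \<noteq> 1\<close> may fail and the class \<^class>\<open>ring_1\<close> is not available.\<close>

instantiation bop :: (complex_normed_vector) "{ring, monoid_mult, complex_vector}"
begin

lift_definition zero_bop :: "'a bop" is "\<lambda>x. 0"
  by simp

lift_definition one_bop :: "'a bop" is "\<lambda>x. x"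
  by (simp add: bounded_linear_ident)

lift_definition plus_bop :: "'a bop \<Rightarrow> 'a bop \<Rightarrow> 'a bop" is "\<lambda>A B x. A x + B x"
  by (simp add: bounded_linear_add scaleC_add_right)

lift_definition uminus_bop :: "'a bop \<Rightarrow> 'a bop" is "\<lambda>A x. - A x"
  by (simp add: bounded_linear_minus scaleC_minus_right)

lift_definition minus_bop :: "'a bop \<Rightarrow> 'a bop \<Rightarrow> 'a bop" is "\<lambda>A B x. A x - B x"
  by (simp add: bounded_linear_sub scaleC_diff_right)

lift_definition times_bop :: "'a bop \<Rightarrow> 'a bop \<Rightarrow> 'a bop" is "\<lambda>A B x. A (B x)"
  by (simp add: bounded_linear_compose)

lift_definition scaleC_bop :: "complex \<Rightarrow> 'a bop \<Rightarrow> 'a bop" is "\<lambda>c A x. c *\<^sub>C A x"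
  by (auto intro: bounded_linear_compose[OF bounded_linear_scaleC_right]
      simp: scaleC_scaleC mult.commute)

instance
  by standard
    (transfer; auto simp: fun_eq_iff algebra_simps scaleC_add_right scaleC_add_left
      scaleC_scaleC scaleC_one linear_simps)+

end


section \<open>Lie centralizable mappings\<close>

definition lie :: "'a::ring \<Rightarrow> 'a \<Rightarrow> 'a"
  where "lie A B = A * B - B * A"

definition lie_centralizable_at :: "'a::ring \<Rightarrow> ('a \<Rightarrow> 'a) \<Rightarrow> bool"
  where "lie_centralizable_at Z \<phi> \<longleftrightarrow>
    (\<forall>A B. A * B = Z \<longrightarrow> \<phi> (lie A B) = lie (\<phi> A) B \<and> \<phi> (lie A B) = lie A (\<phi> B))"

definition scalar_operators :: "'a::complex_normed_vector bop set"
  where "scalar_operators = {\<eta> *\<^sub>C 1 | \<eta>. True}"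

end

theory Submission
  imports Defs
begin

text \<open>
  If \<open>\<phi> A = \<lambda> A + \<mu> A\<close>, scalar terms drop out of all commutators, and the identities at \<open>\<xi> I\<close> are
  immediate. The content is the converse, and both cases \<open>\<xi> = 0\<close> and \<open>\<xi> \<noteq> 0\<close> pass through one
  intermediate property:
  \<open>[\<phi>(A), P] = [A, \<phi>(P)]\<close> for every operator \<open>A\<close> and every idempotent \<open>P\<close>.

  For \<open>\<xi> = 0\<close> it comes from the zero products \<open>AP \<cdot> (1 - P)\<close> and \<open>A(1 - P) \<cdot> P\<close>, whose left
  factors add up to \<open>A\<close> (\<open>lie_centralizable_at_zero_idempotent\<close>). For \<open>\<xi> \<noteq> 0\<close> an invertible \<open>T\<close>
  satisfies \<open>T \<cdot> \<xi> T\<inverse> = \<xi> I\<close> with vanishing commutator, so \<open>\<phi>(T)\<close> commutes with \<open>T\<close>; since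
  \<open>A + cI\<close> is invertible for large \<open>c\<close>, additivity extends this to all \<open>A\<close>
  (\<open>lie_centralizable_at_nonzero_commuting\<close>), and linearising \<open>[\<phi>(A), A] = 0\<close> gives the property
  even for all pairs.

  From then on one idempotent is treated at a time. Every commutator \<open>[T, P]\<close> with
  an idempotent maps the range of \<open>P\<close> to its kernel and back. So with \<open>S = \<phi>(P)\<close> all the values
  \<open>[A, S] = [\<phi>(A), P]\<close> of the derivation \<open>A \<mapsto> [A, S]\<close> are off-diagonal; comparing this for \<open>A\<close>,
  \<open>C\<close> and \<open>AC\<close> leads to \<open>[A, P] Z [C, S] = [A, S] Z [C, P]\<close>
  (\<open>off_diagonal_commutator_identity\<close>). Taking rank-one operators for \<open>Z\<close> shows
  \<open>[\<phi>(A), P] = \<lambda>\<^sub>P [A, P]\<close> for all \<open>A\<close>. Finally fix a functional \<open>f \<noteq> 0\<close> and let \<open>P\<close> run over the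
  idempotents \<open>z \<mapsto> f(z) y\<close> with \<open>f(y) = 1\<close>. No two different ones commute, which forces all the
  \<open>\<lambda>\<^sub>P\<close> to agree, and an operator commuting with all of them is a scalar; hence \<open>\<phi>(A) - \<lambda> A\<close> is a
  scalar (\<open>centralizer_is_scalar_plus_central\<close>).

  Rank-one operators are useful only if bounded functionals separate points, so the
  argument rests on the Hahn-Banach theorem, in the form that some bounded functional is nonzero
  at a given nonzero vector. It is obtained from minimal sublinear functionals.
\<close>

section \<open>Bounded functionals on a complex normed space\<close>

text \<open>Homogeneity is required only as an inequality, which is what has to be checked for the infima
  below; equality follows by applying it to \<open>t\<close> and \<open>1 / t\<close>.\<close>

definition sublinear :: "('a::real_vector \<Rightarrow> real) \<Rightarrow> bool"
  where "sublinear p \<longleftrightarrow> (\<forall>x y. p (x + y) \<le> p x + p y) \<and>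
    (\<forall>t x. 0 \<le> t \<longrightarrow> p (t *\<^sub>R x) \<le> t * p x)"

lemma sublinearI:
  assumes "\<And>x y. p (x + y) \<le> p x + p y" and "\<And>t x. 0 \<le> t \<Longrightarrow> p (t *\<^sub>R x) \<le> t * p x"
  shows "sublinear p"
  using assms by (simp add: sublinear_def)

lemma sublinear_add: "sublinear p \<Longrightarrow> p (x + y) \<le> p x + p y"
  by (simp add: sublinear_def)

lemma sublinear_scale_le: "sublinear p \<Longrightarrow> 0 \<le> t \<Longrightarrow> p (t *\<^sub>R x) \<le> t * p x"
  by (simp add: sublinear_def)

lemma sublinear_zero: "sublinear p \<Longrightarrow> p 0 = 0"
  using sublinear_add[of p 0 0] sublinear_scale_le[of p 0 0] by simp

lemma sublinear_minus_ge: "sublinear p \<Longrightarrow> - p (- x) \<le> p x"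
  using sublinear_add[of p x "- x"] sublinear_zero[of p] by simp

lemma sublinear_scale:
  assumes "sublinear p" and "0 \<le> t"
  shows "p (t *\<^sub>R x) = t * p x"
proof (cases "t = 0")
  case True
  then show ?thesis by (simp add: sublinear_zero[OF assms(1)])
next
  case False
  with assms(2) have "0 < t" by simp
  have "p ((1 / t) *\<^sub>R (t *\<^sub>R x)) \<le> (1 / t) * p (t *\<^sub>R x)"
    using \<open>0 < t\<close> by (intro sublinear_scale_le[OF assms(1)]) simp
  then have "t * p x \<le> p (t *\<^sub>R x)"
    using \<open>0 < t\<close> by (simp add: field_simps)
  with sublinear_scale_le[OF assms, of x] show ?thesis by simp
qed

lemma sublinear_norm: "sublinear (norm :: 'a::real_normed_vector \<Rightarrow> real)"
  by (rule sublinearI) (simp_all add: norm_triangle_ineq)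

text \<open>The infimum over \<open>t \<ge> 0\<close> of \<open>p (x + t y) - t p y\<close> is the largest sublinear \<open>q \<le> p\<close> with
  \<open>q (- y) \<le> - p y\<close>. It serves twice: to start from a functional below the norm that is negative at a
  prescribed vector, and to see that a minimal sublinear functional is odd.\<close>

lemma sublinear_lower_in_direction:
  assumes p: "sublinear p"
  obtains q where "sublinear q" and "\<And>x. q x \<le> p x" and "q (- y) \<le> - p y"
proof -
  define q where "q x = (INF t\<in>{0..}. p (x + t *\<^sub>R y) - t * p y)" for x
  have low: "- p (- x) \<le> p (x + t *\<^sub>R y) - t * p y" if "0 \<le> t" for x t
    using sublinear_add[OF p, of "x + t *\<^sub>R y" "- x"] sublinear_scale[OF p that, of y] by simp
  have bdd: "bdd_below ((\<lambda>t. p (x + t *\<^sub>R y) - t * p y) ` {0..})" for x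
    by (rule bdd_belowI2[of _ "- p (- x)"]) (simp add: low)
  have q_le: "q x \<le> p (x + t *\<^sub>R y) - t * p y" if "0 \<le> t" for x t
    unfolding q_def using bdd that by (intro cINF_lower) auto
  have le_q: "m \<le> q x" if "\<And>t. 0 \<le> t \<Longrightarrow> m \<le> p (x + t *\<^sub>R y) - t * p y" for m x
    unfolding q_def using that by (intro cINF_greatest) auto
  have "sublinear q"
  proof (rule sublinearI)
    fix x x'
    have "q (x + x') \<le> (p (x + t *\<^sub>R y) - t * p y) + (p (x' + t' *\<^sub>R y) - t' * p y)"
      if "0 \<le> t" "0 \<le> t'" for t t'
    proof -
      have "q (x + x') \<le> p ((x + x') + (t + t') *\<^sub>R y) - (t + t') * p y"
        using that by (intro q_le) simp
      also have "(x + x') + (t + t') *\<^sub>R y = (x + t *\<^sub>R y) + (x' + t' *\<^sub>R y)"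
        by (simp add: algebra_simps)
      finally show ?thesis
        using sublinear_add[OF p, of "x + t *\<^sub>R y" "x' + t' *\<^sub>R y"] by (simp add: algebra_simps)
    qed
    then have "q (x + x') - (p (x' + t' *\<^sub>R y) - t' * p y) \<le> q x" if "0 \<le> t'" for t'
      using that by (intro le_q) (simp add: algebra_simps)
    then have "q (x + x') - q x \<le> q x'"
      by (intro le_q) (simp add: algebra_simps)
    then show "q (x + x') \<le> q x + q x'" by simp
  next
    fix s :: real and x
    assume "0 \<le> s"
    show "q (s *\<^sub>R x) \<le> s * q x"
    proof (cases "s = 0")
      case True
      then show ?thesis using q_le[of 0 0] by (simp add: sublinear_zero[OF p])
    next
      case False
      with \<open>0 \<le> s\<close> have s: "0 < s" by simp
      have "q (s *\<^sub>R x) / s \<le> q x"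
      proof (rule le_q)
        fix t :: real
        assume "0 \<le> t"
        have "q (s *\<^sub>R x) \<le> p (s *\<^sub>R x + (s * t) *\<^sub>R y) - (s * t) * p y"
          using s \<open>0 \<le> t\<close> by (intro q_le) simp
        also have "s *\<^sub>R x + (s * t) *\<^sub>R y = s *\<^sub>R (x + t *\<^sub>R y)"
          by (simp add: algebra_simps)
        also have "p \<dots> = s * p (x + t *\<^sub>R y)"
          using s by (intro sublinear_scale[OF p]) simp
        finally show "q (s *\<^sub>R x) / s \<le> p (x + t *\<^sub>R y) - t * p y"
          using s by (simp add: field_simps)
      qed
      then show ?thesis using s by (simp add: field_simps)
    qed
  qed
  moreover have "q x \<le> p x" for x
    using q_le[of 0 x] by simp
  moreover have "q (- y) \<le> - p y"
    using q_le[of 1 "- y"] by (simp add: sublinear_zero[OF p])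
  ultimately show ?thesis by (rule that)
qed

text \<open>Zorn: a sublinear \<open>p \<le> p0\<close> satisfies \<open>p x \<ge> - p (- x) \<ge> - p0 (- x)\<close>, so the pointwise infimum
  of a chain is finite, and because the chain is totally ordered the infimum is again subadditive.\<close>

lemma exists_minimal_sublinear:
  assumes p0: "sublinear p0"
  obtains p where "sublinear p" and "p \<le> p0"
    and "\<And>q. sublinear q \<Longrightarrow> q \<le> p \<Longrightarrow> q = p"
proof -
  define S where "S = {p. sublinear p \<and> p \<le> p0}"
  let ?R = "relation_of (\<lambda>p q. q \<le> p) S"
  have "\<exists>m\<in>S. \<forall>a\<in>S. a \<le> m \<longrightarrow> a = m"
  proof (rule predicate_Zorn)
    show "partial_order_on S ?R"
      by (rule partial_order_on_relation_ofI) auto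
  next
    fix C
    assume C: "C \<in> Chains ?R"
    have CS: "p \<in> S" if "p \<in> C" for p
      using C that by (auto simp: Chains_def relation_of_def)
    have total: "p \<le> q \<or> q \<le> p" if "p \<in> C" "q \<in> C" for p q
      using C that by (auto simp: Chains_def relation_of_def)
    show "\<exists>u\<in>S. \<forall>a\<in>C. u \<le> a"
    proof (cases "C = {}")
      case True
      then show ?thesis using p0 by (auto simp: S_def)
    next
      case False
      define u where "u x = (INF p\<in>C. p x)" for x
      have bdd: "bdd_below ((\<lambda>p. p x) ` C)" for x
      proof (rule bdd_belowI2)
        fix p
        assume "p \<in> C"
        then have "sublinear p" and "p (- x) \<le> p0 (- x)"
          using CS by (auto simp: S_def le_fun_def)
        then show "- p0 (- x) \<le> p x"
          using sublinear_minus_ge[of p x] by linarith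
      qed
      have u_le: "u x \<le> p x" if "p \<in> C" for p x
        unfolding u_def using bdd that by (intro cINF_lower) auto
      have le_u: "m \<le> u x" if "\<And>p. p \<in> C \<Longrightarrow> m \<le> p x" for m x
        unfolding u_def using that False by (intro cINF_greatest) auto
      have "sublinear u"
      proof (rule sublinearI)
        fix x y
        have "u (x + y) \<le> p x + q y" if pq: "p \<in> C" "q \<in> C" for p q
        proof -
          \<comment> \<open>A single member of the chain below both \<open>p\<close> and \<open>q\<close> allows its subadditivity to be used.\<close>
          obtain r where r: "r \<in> C" "r \<le> p" "r \<le> q"
            using total[OF pq] pq by blast
          have "u (x + y) \<le> r x + r y"
            using u_le[OF r(1), of "x + y"] sublinear_add[of r x y] CS[OF r(1)]
            by (simp add: S_def)
          also have "\<dots> \<le> p x + q y"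
            using r by (intro add_mono) (auto simp: le_fun_def)
          finally show ?thesis .
        qed
        then have "u (x + y) - q y \<le> u x" if "q \<in> C" for q
          using that by (intro le_u) (simp add: algebra_simps)
        then have "u (x + y) - u x \<le> u y"
          by (intro le_u) (simp add: algebra_simps)
        then show "u (x + y) \<le> u x + u y" by simp
      next
        fix t :: real and x
        assume "0 \<le> t"
        have *: "u (t *\<^sub>R x) \<le> t * p x" if "p \<in> C" for p
          using u_le[OF that, of "t *\<^sub>R x"] sublinear_scale_le[of p t x] CS[OF that] \<open>0 \<le> t\<close>
          by (simp add: S_def)
        show "u (t *\<^sub>R x) \<le> t * u x"
        proof (cases "t = 0")
          case True
          then show ?thesis using * False by auto
        next
          case False
          with \<open>0 \<le> t\<close> have "0 < t" by simp
          then have "u (t *\<^sub>R x) / t \<le> u x"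
            using * by (intro le_u) (simp add: field_simps)
          with \<open>0 < t\<close> show ?thesis by (simp add: field_simps)
        qed
      qed
      moreover have "u \<le> p0"
      proof -
        obtain p where "p \<in> C" using False by blast
        then have "u \<le> p" and "p \<le> p0"
          using u_le CS by (auto simp: le_fun_def S_def)
        then show ?thesis by (rule order_trans)
      qed
      ultimately show ?thesis
        using u_le by (intro bexI[of _ u]) (auto simp: S_def le_fun_def)
    qed
  qed
  then obtain m where "m \<in> S" and min: "\<And>a. a \<in> S \<Longrightarrow> a \<le> m \<Longrightarrow> a = m" by blast
  show ?thesis
  proof (rule that)
    show "sublinear m" and "m \<le> p0" using \<open>m \<in> S\<close> by (auto simp: S_def)
    then show "q = m" if "sublinear q" "q \<le> m" for q
      using that by (intro min) (auto simp: S_def intro: order_trans)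
  qed
qed

text \<open>Lowering \<open>p\<close> in the direction \<open>y\<close> changes nothing, so \<open>p (- y) = - p y\<close>; an odd sublinear
  functional satisfies its inequalities in both directions.\<close>

lemma minimal_sublinear_linear:
  assumes p: "sublinear p" and min: "\<And>q. sublinear q \<Longrightarrow> q \<le> p \<Longrightarrow> q = p"
  shows "linear p"
proof -
  have neg: "p (- y) = - p y" for y
  proof -
    obtain q where "sublinear q" "\<And>x. q x \<le> p x" "q (- y) \<le> - p y"
      using sublinear_lower_in_direction[OF p, of y] by blast
    then have "p (- y) \<le> - p y"
      using min[of q] by (simp add: le_fun_def)
    with sublinear_minus_ge[OF p, of y] show ?thesis by linarith
  qed
  show ?thesis
  proof (rule linearI)
    show "p (x + y) = p x + p y" for x y
      using sublinear_add[OF p, of x y] sublinear_add[OF p, of "- x" "- y"] neg[of "x + y"]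
      by (simp add: neg)
    show "p (r *\<^sub>R x) = r *\<^sub>R p x" for r x
    proof (cases "0 \<le> r")
      case True
      then show ?thesis by (simp add: sublinear_scale[OF p])
    next
      case False
      then show ?thesis
        using sublinear_scale[OF p, of "- r" x] neg[of "r *\<^sub>R x"] by simp
    qed
  qed
qed

text \<open>A linear functional below the norm is bounded, since it is also above minus the norm; starting
  from the norm lowered in the direction \<open>x\<close> keeps the minimal functional nonzero at \<open>x\<close>.\<close>

lemma exists_bounded_real_functional:
  fixes x :: "'a::real_normed_vector"
  assumes "x \<noteq> 0"
  obtains u :: "'a \<Rightarrow> real" where "bounded_linear u" and "u x \<noteq> 0"
proof -
  obtain q where q: "sublinear q" "\<And>y. q y \<le> norm y" "q (- x) \<le> - norm x"
    using sublinear_lower_in_direction[OF sublinear_norm, of x] by blast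
  obtain u where u: "sublinear u" "u \<le> q" "\<And>r. sublinear r \<Longrightarrow> r \<le> u \<Longrightarrow> r = u"
    using exists_minimal_sublinear[OF q(1)] by blast
  have lin: "linear u"
    using u by (intro minimal_sublinear_linear)
  have le: "u y \<le> norm y" for y
    using u(2) q(2)[of y] by (auto simp: le_fun_def intro: order_trans)
  have "bounded_linear u"
  proof (rule bounded_linear_intro[where K = 1])
    show "norm (u y) \<le> norm y * 1" for y
      using le[of y] le[of "- y"] linear_neg[OF lin, of y] by (simp add: abs_le_iff)
  qed (use lin in \<open>auto simp: linear_add linear_scale\<close>)
  moreover have "u (- x) \<le> - norm x"
    using u(2) q(3) by (auto simp: le_fun_def intro: order_trans)
  then have "u x \<noteq> 0"
    using linear_neg[OF lin, of x] assms by auto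
  ultimately show ?thesis by (rule that)
qed

definition complex_functional :: "('a::complex_normed_vector \<Rightarrow> complex) \<Rightarrow> bool"
  where "complex_functional f \<longleftrightarrow> bounded_linear f \<and> (\<forall>c x. f (c *\<^sub>C x) = c * f x)"

lemma complex_functional_scaleC: "complex_functional f \<Longrightarrow> f (c *\<^sub>C x) = c * f x"
  by (simp add: complex_functional_def)

lemma complex_functional_add_diff:
  assumes "complex_functional f"
  shows "f (x + y) = f x + f y" and "f (x - y) = f x - f y"
  using assms by (auto simp: complex_functional_def linear_simps)

text \<open>The usual complexification \<open>y \<mapsto> u(y) - \<i> u(\<i> y)\<close> of a real functional, normalised at \<open>x\<close>.\<close>

lemma exists_complex_functional:
  fixes x :: "'a::complex_normed_vector"
  assumes "x \<noteq> 0"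
  obtains f where "complex_functional f" and "f x = 1"
proof -
  obtain u :: "'a \<Rightarrow> real" where u: "bounded_linear u" and ux: "u x \<noteq> 0"
    using exists_bounded_real_functional[OF assms] by blast
  define g where "g y = complex_of_real (u y) - \<i> * complex_of_real (u (\<i> *\<^sub>C y))" for y
  have g: "bounded_linear g"
    unfolding g_def
    by (intro bounded_linear_sub bounded_linear_compose[OF bounded_linear_mult_right]
        bounded_linear_compose[OF bounded_linear_of_real] u
        bounded_linear_compose[OF u bounded_linear_scaleC_right])
  have ii: "g (\<i> *\<^sub>C y) = \<i> * g y" for y
  proof -
    have "\<i> *\<^sub>C \<i> *\<^sub>C y = - y"
      using scaleR_scaleC[of "-1" y] by (simp add: scaleC_scaleC)
    then show ?thesis
      by (simp add: g_def linear_simps[OF u] algebra_simps)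
  qed
  have scale: "g (c *\<^sub>C y) = c * g y" for c y
  proof -
    have "c *\<^sub>C y = (complex_of_real (Re c) + complex_of_real (Im c) * \<i>) *\<^sub>C y"
      by (subst complex_eq[of c]) (simp only: mult.commute)
    also have "\<dots> = Re c *\<^sub>R y + Im c *\<^sub>R (\<i> *\<^sub>C y)"
      by (simp only: scaleC_add_left scaleR_scaleC scaleC_scaleC)
    finally have "g (c *\<^sub>C y) = complex_of_real (Re c) * g y + complex_of_real (Im c) * (\<i> * g y)"
      by (simp add: linear_simps[OF g] ii scaleR_conv_of_real)
    also have "\<dots> = (complex_of_real (Re c) + \<i> * complex_of_real (Im c)) * g y"
      by (simp add: algebra_simps)
    finally show ?thesis by (simp flip: complex_eq)
  qed
  have "Re (g x) \<noteq> 0" using ux by (simp add: g_def)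
  then have "g x \<noteq> 0" by auto
  show ?thesis
  proof (rule that)
    show "complex_functional (\<lambda>y. inverse (g x) * g y)"
      unfolding complex_functional_def
      using bounded_linear_compose[OF bounded_linear_mult_right g] by (simp add: scale)
    show "inverse (g x) * g x = 1" using \<open>g x \<noteq> 0\<close> by simp
  qed
qed


section \<open>Bounded operators\<close>

lemma bop_apply_simps [simp]:
  "bop_apply 0 x = 0" "bop_apply 1 x = x"
  "bop_apply (A + B) x = bop_apply A x + bop_apply B x"
  "bop_apply (A - B) x = bop_apply A x - bop_apply B x"
  "bop_apply (A * B) x = bop_apply A (bop_apply B x)"
  "bop_apply (c *\<^sub>C A) x = c *\<^sub>C bop_apply A x"
  by (transfer; simp)+

lemma bop_apply_linear:
  "bounded_linear (bop_apply A)" "bop_apply A (c *\<^sub>C x) = c *\<^sub>C bop_apply A x"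
  by (transfer; simp)+

lemma scaleC_left_minus: "(- a) *\<^sub>C x = - (a *\<^sub>C x)" for x :: "'a::complex_vector"
proof -
  have "(- a) *\<^sub>C x + a *\<^sub>C x = 0 *\<^sub>C x" by (simp flip: scaleC_add_left)
  also have "0 *\<^sub>C x = 0" using scaleC_add_left[of 0 0 x] by simp
  finally show ?thesis by (simp add: eq_neg_iff_add_eq_0)
qed

lemma scaleC_diff_left: "(a - b) *\<^sub>C x = a *\<^sub>C x - b *\<^sub>C x" for x :: "'a::complex_vector"
  using scaleC_add_left[of a "- b" x] by (simp add: scaleC_left_minus)

lemma scaleC_zero_left: "0 *\<^sub>C x = 0" for x :: "'a::complex_vector"
  using scaleC_add_left[of 0 0 x] by simp

lemma scaleC_cancel: "a *\<^sub>C x = a *\<^sub>C y \<Longrightarrow> a \<noteq> 0 \<Longrightarrow> x = y" for x y :: "'a::complex_vector"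
  by (metis scaleC_scaleC scaleC_one left_inverse)

lemma scaleC_cancel_right:
  "a *\<^sub>C x = b *\<^sub>C x \<Longrightarrow> x \<noteq> 0 \<Longrightarrow> a = b" for x :: "'a::complex_vector"
  using scaleC_cancel[of "a - b" x 0] by (auto simp: scaleC_diff_left)

lemma bop_mult_scaleC:
  fixes A B :: "'a::complex_normed_vector bop"
  shows "(c *\<^sub>C A) * B = c *\<^sub>C (A * B)" "A * (c *\<^sub>C B) = c *\<^sub>C (A * B)"
  by (rule bop_eqI; simp add: bop_apply_linear)+

lemma lie_scaleC:
  fixes A B :: "'a::complex_normed_vector bop"
  shows "lie (c *\<^sub>C A) B = c *\<^sub>C lie A B" "lie A (c *\<^sub>C B) = c *\<^sub>C lie A B"
  by (simp_all add: lie_def bop_mult_scaleC scaleC_diff_right)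

lemma lie_add_left: "lie (A + B) C = lie A C + lie B C"
  and lie_add_right: "lie A (B + C) = lie A B + lie A C"
  and lie_diff_left: "lie (A - B) C = lie A C - lie B C"
  and lie_diff_right: "lie A (B - C) = lie A B - lie A C"
  by (simp_all add: lie_def algebra_simps)

lemma lie_commute: "lie A B = - lie B A"
  by (simp add: lie_def)

lemma lie_one: "lie (1 :: 'a::complex_normed_vector bop) A = 0" "lie A (1 :: 'a bop) = 0"
  by (simp_all add: lie_def)

text \<open>The operator \<open>y \<otimes> f\<close>; it is meaningful only for bounded complex-linear \<open>f\<close>.\<close>

definition rank_one :: "'a::complex_normed_vector \<Rightarrow> ('a \<Rightarrow> complex) \<Rightarrow> 'a bop"
  where "rank_one y f = Bop (\<lambda>x. f x *\<^sub>C y)"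

lemma rank_one_apply:
  assumes "complex_functional f"
  shows "bop_apply (rank_one y f) x = f x *\<^sub>C y"
proof -
  have f: "bounded_linear f" and scale: "f (c *\<^sub>C z) = c * f z" for c z
    using assms by (auto simp: complex_functional_def)
  obtain K where K: "\<And>z. norm (f z) \<le> norm z * K"
    using bounded_linear.bounded[OF f] by blast
  have "bounded_linear (\<lambda>z. f z *\<^sub>C y)"
  proof (rule bounded_linear_intro[where K = "K * norm y"])
    show "norm (f z *\<^sub>C y) \<le> norm z * (K * norm y)" for z
      using mult_right_mono[OF K[of z], of "norm y"] by (simp add: norm_scaleC mult.assoc)
  qed (simp_all add: linear_simps[OF f] scaleC_add_left scaleR_scaleC scaleC_scaleC scale)
  then show ?thesis
    unfolding rank_one_def by (subst Bop_inverse) (auto simp: scale scaleC_scaleC)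
qed

text \<open>For \<open>c\<close> above a bound \<open>K\<close> of \<open>A\<close>, solving \<open>A x + c x = z\<close> means finding a fixed point of the
  contraction \<open>x \<mapsto> (z - A x) / c\<close>. Uniqueness makes the solution linear in \<open>z\<close>, and
  \<open>\<parallel>A x + c x\<parallel> \<ge> (c - K) \<parallel>x\<parallel>\<close> makes it bounded.\<close>

lemma exists_inverse_of_large_translate:
  fixes A :: "'a::complex_banach bop"
  obtains c0 :: real where "\<And>c. c0 < c \<Longrightarrow>
    \<exists>B. (A + complex_of_real c *\<^sub>C 1) * B = 1 \<and> B * (A + complex_of_real c *\<^sub>C 1) = 1"
proof -
  note linA = bop_apply_linear[of A]
  obtain K where "0 < K" and K: "\<And>x. norm (bop_apply A x) \<le> norm x * K"
    using bounded_linear.pos_bounded[OF linA(1)] by blast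
  have "\<exists>B. (A + complex_of_real c *\<^sub>C 1) * B = 1 \<and> B * (A + complex_of_real c *\<^sub>C 1) = 1"
    if "K < c" for c
  proof -
    let ?T = "bop_apply (A + complex_of_real c *\<^sub>C 1)"
    note linT = bop_apply_linear[of "A + complex_of_real c *\<^sub>C 1"]
    have "0 < c" using that \<open>0 < K\<close> by simp
    have T: "?T x = bop_apply A x + c *\<^sub>R x" for x by (simp add: scaleR_scaleC)
    have ex1: "\<exists>!x. ?T x = z" for z
    proof -
      have "\<exists>!x. (1 / c) *\<^sub>R (z - bop_apply A x) = x"
      proof (rule banach_fix_type[where c = "K / c"], goal_cases)
        case 3
        have "dist ((1 / c) *\<^sub>R (z - bop_apply A x)) ((1 / c) *\<^sub>R (z - bop_apply A y))
            \<le> K / c * dist x y" for x y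
        proof -
          have "(1 / c) *\<^sub>R (z - bop_apply A x) - (1 / c) *\<^sub>R (z - bop_apply A y)
              = (1 / c) *\<^sub>R bop_apply A (y - x)"
            by (simp add: linear_simps[OF linA(1)] algebra_simps)
          then show ?thesis
            using K[of "y - x"] \<open>0 < c\<close> by (simp add: dist_norm norm_minus_commute field_simps)
        qed
        then show ?case by blast
      qed (use that \<open>0 < K\<close> \<open>0 < c\<close> in auto)
      moreover have "(1 / c) *\<^sub>R (z - bop_apply A x) = x \<longleftrightarrow> ?T x = z" for x
      proof -
        have "(1 / c) *\<^sub>R (z - bop_apply A x) = x \<longleftrightarrow> z - bop_apply A x = c *\<^sub>R x"
          using \<open>0 < c\<close> scaleR_cancel_left[of c "(1 / c) *\<^sub>R (z - bop_apply A x)" x] by simp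
        then show ?thesis unfolding T by (auto simp: algebra_simps)
      qed
      ultimately show ?thesis by simp
    qed
    define g where "g z = (THE x. ?T x = z)" for z
    have Tg: "?T (g z) = z" for z
      unfolding g_def by (rule theI'[OF ex1])
    have gI: "g z = x" if "?T x = z" for x z
      using ex1[of z] Tg[of z] that by blast
    have bound: "(c - K) * norm x \<le> norm (?T x)" for x
    proof -
      have "c * norm x = norm (?T x - bop_apply A x)"
        using \<open>0 < c\<close> by (simp only: T) simp
      also have "\<dots> \<le> norm (?T x) + norm x * K"
        using norm_triangle_ineq4[of "?T x" "bop_apply A x"] K[of x] by linarith
      finally show ?thesis by (simp add: algebra_simps)
    qed
    have "bounded_linear g"
    proof (rule bounded_linear_intro[where K = "1 / (c - K)"])
      show "g (x + y) = g x + g y" for x y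
        by (rule gI) (simp only: linear_simps[OF linT(1)] Tg)
      show "g (r *\<^sub>R x) = r *\<^sub>R g x" for r x
        by (rule gI) (simp only: linear_simps[OF linT(1)] Tg)
      show "norm (g z) \<le> norm z * (1 / (c - K))" for z
        using bound[of "g z"] that by (simp only: Tg) (simp add: field_simps)
    qed
    moreover have "g (a *\<^sub>C x) = a *\<^sub>C g x" for a x
      by (rule gI) (simp only: linT(2) Tg)
    ultimately have B: "bop_apply (Bop g) = g"
      by (intro Bop_inverse) auto
    have "(A + complex_of_real c *\<^sub>C 1) * Bop g = 1"
      by (rule bop_eqI) (use Tg B in \<open>simp only: bop_apply_simps(2,5)\<close>)
    moreover have "Bop g * (A + complex_of_real c *\<^sub>C 1) = 1"
      by (rule bop_eqI) (use gI B in \<open>simp only: bop_apply_simps(2,5)\<close>)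
    ultimately show ?thesis by blast
  qed
  then show ?thesis by (rule that)
qed


section \<open>Inner derivations and idempotents\<close>

text \<open>For idempotent \<open>P\<close> the hypothesis says that both diagonal blocks of every \<open>[A, S]\<close> vanish with
  respect to \<open>P\<close>. Applied to the Leibniz expansion of \<open>[AC, S]\<close>, it gives the identity without \<open>Z\<close>;
  replacing \<open>A\<close> by \<open>A Z\<close> there and expanding again leaves the term with \<open>Z\<close> in the middle.\<close>

lemma off_diagonal_commutator_identity:
  fixes P S :: "'a::ring"
  assumes off: "\<And>A. lie A S = P * lie A S + lie A S * P"
  shows "lie A P * Z * lie C S = lie A S * Z * lie C P"
proof -
  have prod: "lie A P * lie C S = lie A S * lie C P" for A C
  proof -
    have leib: "lie (A * C) S = A * lie C S + lie A S * C"
      by (simp add: lie_def algebra_simps)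
    have "A * lie C S + lie A S * C
        = P * (A * lie C S + lie A S * C) + (A * lie C S + lie A S * C) * P"
      using off[of "A * C"] by (simp only: leib)
    then have "A * (P * lie C S + lie C S * P) + (P * lie A S + lie A S * P) * C
        = P * (A * lie C S + lie A S * C) + (A * lie C S + lie A S * C) * P"
      by (simp only: off[symmetric])
    then have "A * P * lie C S + lie A S * P * C = P * A * lie C S + lie A S * C * P"
      by (simp add: distrib_left distrib_right mult.assoc add_ac)
    then show ?thesis
      by (simp add: lie_def[of _ P] algebra_simps)
  qed
  have "lie (A * Z) P = A * lie Z P + lie A P * Z" "lie (A * Z) S = A * lie Z S + lie A S * Z"
    by (simp_all add: lie_def algebra_simps)
  with prod[of "A * Z" C] have "A * (lie Z P * lie C S) + lie A P * Z * lie C S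
      = A * (lie Z S * lie C P) + lie A S * Z * lie C P"
    by (simp add: distrib_right mult.assoc)
  then show ?thesis by (simp add: prod)
qed

text \<open>With \<open>Z = u \<otimes> f\<close>, the identity above, applied to a vector \<open>v\<close>, reads
  \<open>f([C, S] v) [A, P] u = f([C, P] v) [A, S] u\<close>. If \<open>P\<close> is not central, \<open>C\<close>, \<open>v\<close> and \<open>f\<close> can be
  chosen with \<open>f([C, P] v) = 1\<close>.\<close>

lemma lie_proportional_to_lie_idempotent:
  fixes P S :: "'a::complex_normed_vector bop"
  assumes P: "P * P = P" and inner: "\<And>A. \<exists>T. lie A S = lie T P"
  obtains c where "\<And>A. lie A S = c *\<^sub>C lie A P"
proof (cases "\<forall>B. lie B P = 0")
  case True
  then have "lie A S = 0 *\<^sub>C lie A P" for A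
    using inner[of A] by auto
  then show ?thesis by (rule that)
next
  case False
  have "lie T P = P * lie T P + lie T P * P" for T
    using P by (simp add: lie_def algebra_simps) (simp flip: mult.assoc)
  then have off: "lie A S = P * lie A S + lie A S * P" for A
    using inner[of A] by auto
  obtain C where "lie C P \<noteq> 0" using False by blast
  then obtain v where "bop_apply (lie C P) v \<noteq> 0"
    using bop_eqI[of "lie C P" 0] by auto
  then obtain f where f: "complex_functional f" "f (bop_apply (lie C P) v) = 1"
    using exists_complex_functional by blast
  have "lie A S = f (bop_apply (lie C S) v) *\<^sub>C lie A P" for A
  proof (rule bop_eqI)
    fix u
    have "bop_apply (lie A P * rank_one u f * lie C S) v
        = bop_apply (lie A S * rank_one u f * lie C P) v"
      by (simp only: off_diagonal_commutator_identity[OF off])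
    then show "bop_apply (lie A S) u = bop_apply (f (bop_apply (lie C S) v) *\<^sub>C lie A P) u"
      by (simp add: rank_one_apply[OF f(1)] f(2) bop_apply_linear(2) scaleC_one)
  qed
  then show ?thesis by (rule that)
qed

lemma rank_one_absorb:
  assumes "complex_functional f" and "f y = 1"
  shows "rank_one x f * rank_one y f = rank_one x f"
  by (rule bop_eqI)
    (simp add: rank_one_apply[OF assms(1)] complex_functional_scaleC[OF assms(1)] assms(2))

text \<open>Evaluating \<open>T (y \<otimes> f) = (y \<otimes> f) T\<close> at \<open>x\<close> gives \<open>T y = f(T x) y\<close>, with a factor
  independent of \<open>y\<close>; and every vector is a combination of vectors in the hyperplane \<open>f = 1\<close>.\<close>

lemma scalar_if_commutes_with_rank_one_idempotents:
  assumes f: "complex_functional f" and x: "f x = 1"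
    and comm: "\<And>y. f y = 1 \<Longrightarrow> lie T (rank_one y f) = 0"
  shows "T \<in> scalar_operators"
proof -
  note T = bop_apply_linear[of T]
  have unit: "bop_apply T y = f (bop_apply T x) *\<^sub>C y" if "f y = 1" for y
  proof -
    have "bop_apply (T * rank_one y f) x = bop_apply (rank_one y f * T) x"
      using comm[OF that] by (simp add: lie_def)
    then show ?thesis
      by (simp add: rank_one_apply[OF f] x scaleC_one)
  qed
  have scal: "bop_apply T y = f (bop_apply T x) *\<^sub>C y" for y
  proof -
    \<comment> \<open>The translate of \<open>y\<close> along \<open>x\<close> that lies in the hyperplane \<open>f = 1\<close>.\<close>
    define w where "w = y + (1 - f y) *\<^sub>C x"
    have "f w = 1"
      by (simp add: w_def complex_functional_add_diff[OF f] complex_functional_scaleC[OF f] x)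
    have y: "y = w - (1 - f y) *\<^sub>C x" by (simp add: w_def)
    have "bop_apply T y = bop_apply T w - (1 - f y) *\<^sub>C bop_apply T x"
      by (subst y) (simp only: linear_simps[OF T(1)] T(2))
    also have "\<dots> = f (bop_apply T x) *\<^sub>C w - (1 - f y) *\<^sub>C f (bop_apply T x) *\<^sub>C x"
      using unit[OF \<open>f w = 1\<close>] unit[OF x] by simp
    also have "\<dots> = f (bop_apply T x) *\<^sub>C (w - (1 - f y) *\<^sub>C x)"
      by (simp add: scaleC_diff_right scaleC_scaleC mult.commute)
    finally show ?thesis by (simp flip: y)
  qed
  have "T = f (bop_apply T x) *\<^sub>C 1"
    by (rule bop_eqI) (simp only: bop_apply_simps(2,6), rule scal)
  then show ?thesis by (auto simp: scalar_operators_def)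
qed

lemma scalar_operators_zero_space:
  fixes T :: "'a::complex_normed_vector bop"
  assumes "\<And>x :: 'a. x = 0"
  shows "T \<in> scalar_operators"
proof -
  have "T = 0 *\<^sub>C 1" by (rule bop_eqI) (rule trans[OF assms assms[symmetric]])
  then show ?thesis by (auto simp: scalar_operators_def)
qed

lemma scalar_if_commutes_with_idempotents:
  fixes T :: "'a::complex_normed_vector bop"
  assumes comm: "\<And>P. P * P = P \<Longrightarrow> lie T P = 0"
  shows "T \<in> scalar_operators"
proof (cases "\<forall>x :: 'a. x = 0")
  case True
  show ?thesis by (rule scalar_operators_zero_space) (rule True[rule_format])
next
  case False
  then obtain x :: 'a and f where f: "complex_functional f" "f x = 1"
    using exists_complex_functional by blast
  show ?thesis
  proof (rule scalar_if_commutes_with_rank_one_idempotents[OF f])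
    show "lie T (rank_one y f) = 0" if "f y = 1" for y
      by (rule comm[OF rank_one_absorb[OF f(1) that]])
  qed
qed

lemma lie_scalar_operator:
  fixes A T :: "'a::complex_normed_vector bop"
  assumes "T \<in> scalar_operators"
  shows "lie T A = 0" and "lie A T = 0"
proof -
  obtain c where c: "T = c *\<^sub>C 1" using assms unfolding scalar_operators_def by blast
  show "lie T A = 0" by (simp only: c lie_scaleC lie_one scaleC_zero_right)
  show "lie A T = 0" by (simp only: c lie_scaleC lie_one scaleC_zero_right)
qed

text \<open>Each idempotent \<open>y \<otimes> f\<close> with \<open>f(y) = 1\<close> has its own factor. For \<open>P = x \<otimes> f\<close> and \<open>Q = y \<otimes> f\<close>,
  computing \<open>[\<phi>(P), Q] = [P, \<phi>(Q)]\<close> from either side gives \<open>\<lambda>\<^sub>Q [P, Q] = \<lambda>\<^sub>P [P, Q]\<close>, and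
  \<open>[P, Q] = P - Q\<close> vanishes only for \<open>x = y\<close>. Hence \<open>\<phi>(A) - \<lambda> A\<close> commutes with all these
  idempotents.\<close>

lemma centralizer_is_scalar_plus_central:
  fixes \<phi> :: "'a::complex_normed_vector bop \<Rightarrow> 'a bop"
  assumes \<phi>: "\<And>A P. P * P = P \<Longrightarrow> lie (\<phi> A) P = lie A (\<phi> P)"
  obtains c where "\<And>A. \<phi> A - c *\<^sub>C A \<in> scalar_operators"
proof (cases "\<forall>x :: 'a. x = 0")
  case True
  have "\<phi> A - 0 *\<^sub>C A \<in> scalar_operators" for A
    by (rule scalar_operators_zero_space) (rule True[rule_format])
  then show ?thesis by (rule that)
next
  case False
  then obtain x :: 'a and f where f: "complex_functional f" and x: "f x = 1"
    using exists_complex_functional by blast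
  have idem: "rank_one y f * rank_one y f = rank_one y f" if "f y = 1" for y
    by (rule rank_one_absorb[OF f that])
  have factor: "\<exists>c. \<forall>A. lie (\<phi> A) (rank_one y f) = c *\<^sub>C lie A (rank_one y f)"
    if y: "f y = 1" for y
  proof -
    have "\<exists>T. lie A (\<phi> (rank_one y f)) = lie T (rank_one y f)" for A
      using \<phi>[OF idem[OF y], of A] by metis
    then obtain c where "\<And>A. lie A (\<phi> (rank_one y f)) = c *\<^sub>C lie A (rank_one y f)"
      using lie_proportional_to_lie_idempotent[OF idem[OF y]] by blast
    then show ?thesis
      using \<phi>[OF idem[OF y]] by auto
  qed
  obtain c where c: "\<And>A. lie (\<phi> A) (rank_one x f) = c *\<^sub>C lie A (rank_one x f)"
    using factor[OF x] by blast
  have same: "lie (\<phi> A) (rank_one y f) = c *\<^sub>C lie A (rank_one y f)" if y: "f y = 1" for A y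
  proof (cases "y = x")
    case True
    then show ?thesis by (simp add: c)
  next
    case False
    obtain d where d: "\<And>A. lie (\<phi> A) (rank_one y f) = d *\<^sub>C lie A (rank_one y f)"
      using factor[OF y] by blast
    let ?L = "lie (rank_one x f) (rank_one y f)"
    have "d *\<^sub>C ?L = lie (rank_one x f) (\<phi> (rank_one y f))"
      using d[of "rank_one x f"] \<phi>[OF idem[OF y]] by simp
    also have "\<dots> = - (c *\<^sub>C lie (rank_one y f) (rank_one x f))"
      using c[of "rank_one y f"] by (simp add: lie_commute[of "rank_one x f" "\<phi> _"])
    also have "\<dots> = c *\<^sub>C ?L"
      by (simp add: lie_commute[of "rank_one x f"] scaleC_minus_right)
    finally have "d *\<^sub>C ?L = c *\<^sub>C ?L" .
    moreover have "?L \<noteq> 0"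
    proof
      assume "?L = 0"
      then have "bop_apply ?L x = bop_apply 0 x" by simp
      then have "x = y"
        by (simp add: lie_def rank_one_absorb[OF f x] rank_one_absorb[OF f y]
            rank_one_apply[OF f] x y scaleC_one)
      with False show False by simp
    qed
    ultimately have "d = c" by (rule scaleC_cancel_right)
    with d show ?thesis by simp
  qed
  have "\<phi> A - c *\<^sub>C A \<in> scalar_operators" for A
    by (rule scalar_if_commutes_with_rank_one_idempotents[OF f x])
      (simp add: lie_diff_left lie_scaleC same)
  then show ?thesis by (rule that)
qed


section \<open>Additive maps that are Lie centralizable at a scalar\<close>

text \<open>The products \<open>R (1 - R) = 0\<close> make \<open>\<phi>(1)\<close> commute with every idempotent, so \<open>\<phi>(1)\<close> is a scalar.
  Then \<open>1 - R\<close> may be replaced by \<open>- R\<close> in the identities for \<open>A R \<cdot> (1 - R) = 0\<close>, and the cases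
  \<open>R = P\<close> and \<open>R = 1 - P\<close> add up to the claim.\<close>

lemma lie_centralizable_at_zero_idempotent:
  fixes \<phi> :: "'a::complex_normed_vector bop \<Rightarrow> 'a bop"
  assumes add: "Modules.additive \<phi>" and \<phi>: "lie_centralizable_at 0 \<phi>" and P: "P * P = P"
  shows "lie (\<phi> A) P = lie A (\<phi> P)"
proof -
  have cent: "lie (\<phi> A) B = lie A (\<phi> B)" if "A * B = 0" for A B
    using \<phi> that unfolding lie_centralizable_at_def by metis
  have compl: "\<phi> (1 - R) = \<phi> 1 - \<phi> R" for R
    by (rule additive.diff[OF add])
  have "lie (\<phi> 1) R = 0" if R: "R * R = R" for R
  proof -
    have "R * (1 - R) = 0" using R by (simp add: right_diff_distrib)
    moreover have "lie R (1 - R) = 0" by (simp add: lie_def algebra_simps)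
    ultimately have "lie (\<phi> R) (1 - R) = 0" "lie R (\<phi> (1 - R)) = 0"
      using \<phi> additive.zero[OF add] unfolding lie_centralizable_at_def by metis+
    then have "lie (\<phi> R) R = 0" "lie R (\<phi> 1) = lie R (\<phi> R)"
      by (simp_all add: compl lie_diff_right lie_one)
    then show ?thesis
      using lie_commute[of R "\<phi> 1"] lie_commute[of R "\<phi> R"] by simp
  qed
  then have "\<phi> 1 \<in> scalar_operators"
    by (rule scalar_if_commutes_with_idempotents)
  note one = lie_scalar_operator[OF this]
  have right: "lie (\<phi> (A * R)) R = lie (A * R) (\<phi> R)" if R: "R * R = R" for R
  proof -
    have "A * R * (1 - R) = 0" using R by (simp add: right_diff_distrib mult.assoc)
    from cent[OF this] show ?thesis
      by (simp add: compl lie_diff_right lie_one one)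
  qed
  have "(1 - P) * (1 - P) = 1 - P" using P by (simp add: algebra_simps)
  from right[OF this] have "lie (\<phi> (A * (1 - P))) P = lie (A * (1 - P)) (\<phi> P)"
    by (simp add: compl lie_diff_right lie_one one)
  with right[OF P] have "lie (\<phi> (A * P) + \<phi> (A * (1 - P))) P = lie (A * P + A * (1 - P)) (\<phi> P)"
    by (simp add: lie_add_left)
  then show ?thesis
    by (simp add: right_diff_distrib flip: additive.add[OF add])
qed

lemma commuting_additive_lie_swap:
  fixes \<phi> :: "'a::ring \<Rightarrow> 'a"
  assumes add: "Modules.additive \<phi>" and comm: "\<And>A. lie (\<phi> A) A = 0"
  shows "lie (\<phi> A) B = lie A (\<phi> B)"
proof -
  have "lie (\<phi> A) B + lie (\<phi> B) A = 0"
    using comm[of "A + B"]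
    by (simp add: additive.add[OF add] lie_add_left lie_add_right comm add.commute)
  also have "0 = lie A (\<phi> B) + lie (\<phi> B) A"
    by (simp add: lie_commute[of A "\<phi> B"])
  finally show ?thesis by (rule add_right_imp_eq)
qed

text \<open>For large \<open>c\<close> the operator \<open>A + cI\<close> is invertible and commutes with its image, so
  \<open>[\<phi>(A), A] + [\<phi>(cI), A] = 0\<close>. As \<open>\<phi>\<close> is merely additive, \<open>\<phi>(cI)\<close> cannot be computed from
  \<open>\<phi>(I)\<close>, but \<open>\<phi>(2cI) = 2 \<phi>(cI)\<close>; comparing the equation for \<open>c\<close> and \<open>2c\<close> removes the second
  term.\<close>

lemma lie_centralizable_at_nonzero_commuting:
  fixes \<phi> :: "'a::complex_banach bop \<Rightarrow> 'a bop"
  assumes add: "Modules.additive \<phi>" and \<phi>: "lie_centralizable_at (\<xi> *\<^sub>C 1) \<phi>" and "\<xi> \<noteq> 0"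
  shows "lie (\<phi> A) A = 0"
proof -
  have inv: "lie (\<phi> T) T = 0" if TB: "T * B = 1" and BT: "B * T = 1" for T B
  proof -
    have "T * (\<xi> *\<^sub>C B) = \<xi> *\<^sub>C 1" by (simp add: bop_mult_scaleC TB)
    moreover have "lie T (\<xi> *\<^sub>C B) = 0" by (simp add: lie_def bop_mult_scaleC TB BT)
    ultimately have "lie (\<phi> T) (\<xi> *\<^sub>C B) = 0"
      using \<phi> additive.zero[OF add] unfolding lie_centralizable_at_def by metis
    then have "\<xi> *\<^sub>C lie (\<phi> T) B = \<xi> *\<^sub>C 0" by (simp add: lie_scaleC)
    from scaleC_cancel[OF this \<open>\<xi> \<noteq> 0\<close>] have "\<phi> T * B = B * \<phi> T" by (simp add: lie_def)
    then have "T * (\<phi> T * B) * T = T * (B * \<phi> T) * T" by simp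
    then have "T * \<phi> T * (B * T) = (T * B) * \<phi> T * T" by (simp only: mult.assoc)
    then show ?thesis by (simp add: TB BT lie_def)
  qed
  obtain c0 where c0: "\<And>c. c0 < c \<Longrightarrow>
      \<exists>B. (A + complex_of_real c *\<^sub>C 1) * B = 1 \<and> B * (A + complex_of_real c *\<^sub>C 1) = 1"
    using exists_inverse_of_large_translate by blast
  have large: "lie (\<phi> A) A + lie (\<phi> (complex_of_real c *\<^sub>C 1)) A = 0" if "c0 < c" for c
  proof -
    have "lie (\<phi> (A + complex_of_real c *\<^sub>C 1)) (A + complex_of_real c *\<^sub>C 1) = 0"
      using c0[OF that] inv by blast
    then show ?thesis
      by (simp add: additive.add[OF add] lie_add_left lie_add_right lie_scaleC lie_one)
  qed
  define c where "c = \<bar>c0\<bar> + 1"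
  have "complex_of_real (2 * c) *\<^sub>C (1 :: 'a bop) = complex_of_real c *\<^sub>C 1 + complex_of_real c *\<^sub>C 1"
    by (simp flip: scaleC_add_left)
  then have "lie (\<phi> (complex_of_real (2 * c) *\<^sub>C 1)) A
      = lie (\<phi> (complex_of_real c *\<^sub>C 1)) A + lie (\<phi> (complex_of_real c *\<^sub>C 1)) A"
    by (simp add: additive.add[OF add] lie_add_left)
  moreover have "lie (\<phi> A) A + lie (\<phi> (complex_of_real c *\<^sub>C 1)) A = 0"
    "lie (\<phi> A) A + lie (\<phi> (complex_of_real (2 * c) *\<^sub>C 1)) A = 0"
    by (rule large; simp add: c_def)+
  ultimately show ?thesis by (metis add_left_cancel add.right_neutral)
qed

theorem theorem1p2:
  fixes \<xi> :: complex
    and \<phi> :: "'a::complex_banach bop \<Rightarrow> 'a bop"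
  assumes "Modules.additive \<phi>"
  shows "lie_centralizable_at (\<xi> *\<^sub>C 1) \<phi> \<longleftrightarrow>
    (\<exists>(lam :: complex) \<mu> :: 'a bop \<Rightarrow> 'a bop.
      Modules.additive \<mu> \<and> range \<mu> \<subseteq> scalar_operators \<and>
      (\<forall>A B. A * B = \<xi> *\<^sub>C 1 \<longrightarrow> \<mu> (lie A B) = 0) \<and>
      (\<forall>A. \<phi> A = lam *\<^sub>C A + \<mu> A))"
proof
  assume \<phi>: "lie_centralizable_at (\<xi> *\<^sub>C 1) \<phi>"
  have "lie (\<phi> A) P = lie A (\<phi> P)" if "P * P = P" for A P
  proof (cases "\<xi> = 0")
    case True
    with \<phi> have "lie_centralizable_at 0 \<phi>" by (simp add: scaleC_zero_left)
    from lie_centralizable_at_zero_idempotent[OF assms this that] show ?thesis .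
  next
    case False
    show ?thesis
      by (rule commuting_additive_lie_swap[OF assms
            lie_centralizable_at_nonzero_commuting[OF assms \<phi> False]])
  qed
  then obtain c where c: "\<And>A. \<phi> A - c *\<^sub>C A \<in> scalar_operators"
    using centralizer_is_scalar_plus_central by blast
  define \<mu> where "\<mu> A = \<phi> A - c *\<^sub>C A" for A
  have "Modules.additive \<mu>"
    by (rule additive.intro) (simp add: \<mu>_def additive.add[OF assms] scaleC_add_right)
  moreover have "\<mu> (lie A B) = 0" if "A * B = \<xi> *\<^sub>C 1" for A B
  proof -
    have "\<phi> (lie A B) = lie (\<phi> A) B"
      using \<phi> that by (simp add: lie_centralizable_at_def)
    moreover have "lie (\<phi> A - c *\<^sub>C A) B = 0"
      by (rule lie_scalar_operator[OF c])
    ultimately show ?thesis by (simp add: \<mu>_def lie_diff_left lie_scaleC)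
  qed
  ultimately show "\<exists>lam \<mu>. Modules.additive \<mu> \<and> range \<mu> \<subseteq> scalar_operators \<and>
      (\<forall>A B. A * B = \<xi> *\<^sub>C 1 \<longrightarrow> \<mu> (lie A B) = 0) \<and> (\<forall>A. \<phi> A = lam *\<^sub>C A + \<mu> A)"
    using c by (intro exI[of _ c] exI[of _ \<mu>]) (auto simp: \<mu>_def)
next
  assume "\<exists>lam \<mu>. Modules.additive \<mu> \<and> range \<mu> \<subseteq> scalar_operators \<and>
      (\<forall>A B. A * B = \<xi> *\<^sub>C 1 \<longrightarrow> \<mu> (lie A B) = 0) \<and> (\<forall>A. \<phi> A = lam *\<^sub>C A + \<mu> A)"
  then obtain c \<mu> where \<mu>: "\<And>A. \<mu> A \<in> scalar_operators"
    "\<And>A B. A * B = \<xi> *\<^sub>C 1 \<Longrightarrow> \<mu> (lie A B) = 0" "\<And>A. \<phi> A = c *\<^sub>C A + \<mu> A"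
    by blast
  then show "lie_centralizable_at (\<xi> *\<^sub>C 1) \<phi>"
    by (simp add: lie_centralizable_at_def lie_add_left lie_add_right lie_scaleC
        lie_scalar_operator[OF \<mu>(1)])
qed

end
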